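(* Let $(\gamma_j)_{j\ge1}$ be a non-increasing sequence of positive real numbers such that $\sum_{j=1}^{\infty}\gamma_j^t<\infty$ for some real number $t>0$, and let $\boldsymbol{\gamma}$ be the product weights $\gamma_{\mathfrak{u}}=\prod_{j\in\mathfrak{u}}\gamma_j$ for finite nonempty $\mathfrak{u}\subseteq\mathbb{N}$. Then the weighted star discrepancy is polynomially tractable with $s$-exponent at most $2$ and $\varepsilon$-exponent at most $2$.
   Context: Notation: $[s]=\{1,2,\ldots,s\}$. Weighted star discrepancy: for an $N$-element point set $\mathcal{P}=\{\boldsymbol{x}_0,\ldots,\boldsymbol{x}_{N-1}\}$ in $[0,1)^s$ (points counted with multiplicity), the discrepancy function is $$\Delta(\alpha_1,\ldots,\alpha_s)=\frac{A_N\left(\prod_{i=1}^s[0,\alpha_i)\right)}{N}-\alpha_1\cdots\alpha_s ,$$ where $A_N(E)$ is the number of indices $n\in\{0,\ldots,N-1\}$ with $\boldsymbol{x}_n\in E$. For $\boldsymbol{z}\in[0,1]^s$ and $\mathfrak{u}\subseteq[s]$, $(\boldsymbol{z}_{\mathfrak{u}},1)$ denotes the vector $\boldsymbol{z}$ with all components whose indices are not in $\mathfrak{u}$ replaced by $1$. The weighted star discrepancy is $$D_{N,\boldsymbol{\gamma}}^{\ast}(\mathcal{P})=\sup_{\boldsymbol{z}\in[0,1]^s}\max_{\emptyset\neq\mathfrak{u}\subseteq[s]}\gamma_{\mathfrak{u}}\,|\Delta(\boldsymbol{z}_{\mathfrak{u}},1)| .$$ For $s,N\in\mathbb{N}$ let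 $\mathrm{disc}_{\boldsymbol{\gamma}}(N,s)=\inf D_{N,\boldsymbol{\gamma}}^{\ast}(\mathcal{P})$, the infimum taken over all $N$-element point sets $\mathcal{P}$ in $[0,1)^s$. For $\varepsilon\in(0,1)$ and $s\in\mathbb{N}$ let $N_{\min}(\varepsilon,s)=\min\{N\in\mathbb{N}:\mathrm{disc}_{\boldsymbol{\gamma}}(N,s)\le\varepsilon\}$. The weighted star discrepancy is polynomially tractable if there exist nonnegative real numbers $C,\alpha,\beta$ such that $N_{\min}(\varepsilon,s)\le C s^{\alpha}\varepsilon^{-\beta}$ for all $s\in\mathbb{N}$ and all $\varepsilon\in(0,1)$. The infima over all $\alpha,\beta>0$ such that this bound holds are called the $s$-exponent and the $\varepsilon$-exponent, respectively, of polynomial tractability; that the exponents are at most $2$ is understood jointly: for every $\eta>0$ there is a $C$ such that the bound holds with $\alpha=\beta=2+\eta$. *)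

theory Defs
  imports "HOL-Analysis.Analysis"
begin

(* The dimension s varies inside the statements, so a vector in R^s is a function on
   nat that is extensional on the index set {1..s}. A point set of N points, counted with
   multiplicity, is a family x of which only the members x 0, ..., x (N - 1) are used. *)

definition unit_cube :: "nat \<Rightarrow> (nat \<Rightarrow> real) set" where
  "unit_cube s = (\<Pi>\<^sub>E i\<in>{1..s}. {0..1})"

definition half_open_unit_cube :: "nat \<Rightarrow> (nat \<Rightarrow> real) set" where
  "half_open_unit_cube s = (\<Pi>\<^sub>E i\<in>{1..s}. {0..<1})"

definition point_sets :: "nat \<Rightarrow> nat \<Rightarrow> (nat \<Rightarrow> nat \<Rightarrow> real) set" where
  "point_sets N s = {x. \<forall>n<N. x n \<in> half_open_unit_cube s}"

definition count_in :: "nat \<Rightarrow> (nat \<Rightarrow> nat \<Rightarrow> real) \<Rightarrow> (nat \<Rightarrow> real) set \<Rightarrow> nat" where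
  "count_in N x E = card {n. n < N \<and> x n \<in> E}"

definition discrepancy_fun ::
  "nat \<Rightarrow> nat \<Rightarrow> (nat \<Rightarrow> nat \<Rightarrow> real) \<Rightarrow> (nat \<Rightarrow> real) \<Rightarrow> real" where
  "discrepancy_fun s N x \<alpha> =
     real (count_in N x (\<Pi>\<^sub>E i\<in>{1..s}. {0..<\<alpha> i})) / real N - (\<Prod>i\<in>{1..s}. \<alpha> i)"

definition pad_ones :: "nat set \<Rightarrow> (nat \<Rightarrow> real) \<Rightarrow> nat \<Rightarrow> real" where
  "pad_ones u z = (\<lambda>i. if i \<in> u then z i else 1)"

definition weighted_star_discrepancy ::
  "(nat set \<Rightarrow> real) \<Rightarrow> nat \<Rightarrow> nat \<Rightarrow> (nat \<Rightarrow> nat \<Rightarrow> real) \<Rightarrow> real" where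
  "weighted_star_discrepancy w s N x =
     (SUP z\<in>unit_cube s.
        Max ((\<lambda>u. w u * \<bar>discrepancy_fun s N x (pad_ones u z)\<bar>) ` {u. u \<noteq> {} \<and> u \<subseteq> {1..s}}))"

definition disc :: "(nat set \<Rightarrow> real) \<Rightarrow> nat \<Rightarrow> nat \<Rightarrow> real" where
  "disc w N s = (INF x\<in>point_sets N s. weighted_star_discrepancy w s N x)"

(* As an infimum in enat, N_min is the minimum of a nonempty set and infinity for an
   empty one, so an upper bound on it includes the existence of an admissible N. *)
definition N_min :: "(nat set \<Rightarrow> real) \<Rightarrow> real \<Rightarrow> nat \<Rightarrow> enat" where
  "N_min w \<epsilon> s = (INF N\<in>{N. 1 \<le> N \<and> disc w N s \<le> \<epsilon>}. enat N)"

definition tractability_bound :: "(nat set \<Rightarrow> real) \<Rightarrow> real \<Rightarrow> real \<Rightarrow> real \<Rightarrow> bool" where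
  "tractability_bound w C \<alpha> \<beta> \<longleftrightarrow>
     (\<forall>s\<ge>1. \<forall>\<epsilon>. 0 < \<epsilon> \<and> \<epsilon> < 1 \<longrightarrow>
        ereal_of_enat (N_min w \<epsilon> s) \<le> ereal (C * real s powr \<alpha> * \<epsilon> powr (- \<beta>)))"

definition polynomially_tractable :: "(nat set \<Rightarrow> real) \<Rightarrow> bool" where
  "polynomially_tractable w \<longleftrightarrow>
     (\<exists>C \<alpha> \<beta>. 0 \<le> C \<and> 0 \<le> \<alpha> \<and> 0 \<le> \<beta> \<and> tractability_bound w C \<alpha> \<beta>)"

(* Real infima; the sets are nonempty whenever w is polynomially tractable. *)
definition s_exponent :: "(nat set \<Rightarrow> real) \<Rightarrow> real" where
  "s_exponent w = Inf {\<alpha>. 0 < \<alpha> \<and> (\<exists>\<beta>>0. \<exists>C\<ge>0. tractability_bound w C \<alpha> \<beta>)}"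

definition eps_exponent :: "(nat set \<Rightarrow> real) \<Rightarrow> real" where
  "eps_exponent w = Inf {\<beta>. 0 < \<beta> \<and> (\<exists>\<alpha>>0. \<exists>C\<ge>0. tractability_bound w C \<alpha> \<beta>)}"

(* The two exponents are bounded simultaneously. This is stronger than bounding the two
   infima separately, since s_exponent leaves the power of 1/\<epsilon> free and vice versa. *)
definition exponents_jointly_at_most :: "(nat set \<Rightarrow> real) \<Rightarrow> real \<Rightarrow> real \<Rightarrow> bool" where
  "exponents_jointly_at_most w a b \<longleftrightarrow>
     (\<forall>\<eta>>0. \<exists>C\<ge>0. tractability_bound w C (a + \<eta>) (b + \<eta>))"

definition product_weights :: "(nat \<Rightarrow> real) \<Rightarrow> nat set \<Rightarrow> real" where
  "product_weights \<gamma> u = (\<Prod>j\<in>u. \<gamma> j)"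

end

theory Submission
  imports Defs
begin

text \<open>
  Since the weights \<open>\<gamma> j\<close> tend to 0, only finitely many of them exceed 1, so all product weights
  are bounded by the constant \<open>K = (\<Prod>j=1..J. max 1 (\<gamma> j))\<close> (\<open>product_weights_bounded\<close>). A vector
  padded with ones is again a point of the unit cube, hence the weighted star discrepancy is at
  most \<open>K\<close> times the unweighted one (\<open>disc_le\<close>). It remains to find \<open>N\<close> points in dimension \<open>s\<close>
  with star discrepancy at most \<open>\<epsilon> / K\<close>, where \<open>N\<close> is of order \<open>s ln (s / \<epsilon>) / \<epsilon>\<^sup>2\<close>; the logarithm
  is absorbed by an arbitrarily small power of \<open>s / \<epsilon>\<close> (\<open>N_min_le\<close>).

  Such points exist by the classical argument that a random point set does well on the finitely
  many boxes with corners on a grid: a Chernoff bound for each box and a union bound over all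
  boxes. Here the argument is carried out without probability, by the method of conditional
  expectations. The points lie on the grid with mesh \<open>1 / m\<close> and are chosen one after the other. The
  sum over all grid boxes of the exponentials of plus and minus the current error serves as a
  potential, and averaging over the grid shows that some next point multiplies it by at most
  \<open>exp (\<theta>\<^sup>2)\<close> (\<open>ex_sequence_small_potential\<close>). A small potential after \<open>N\<close> steps forces every single
  error to be small (\<open>ex_balanced_sequence\<close>). Finally, an arbitrary box contains the same grid
  points as the grid box obtained by rounding its sides up, and rounding changes the volume by at
  most \<open>s / m\<close> (\<open>ex_point_set_small_discrepancy\<close>).
\<close>

section \<open>Balancing finitely many functions along a sequence\<close>

lemma exp_le_quadratic:
  fixes y :: real
  assumes "\<bar>y\<bar> \<le> 1"
  shows "exp y \<le> 1 + y + y\<^sup>2"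
proof (cases "0 \<le> y")
  case True
  then show ?thesis using exp_bound[of y] assms by simp
next
  case False
  define x where "x = - y"
  have x: "0 < x" "x \<le> 1" using False assms by (auto simp: x_def)
  have "1 \<le> (1 + x) * (1 - x + x\<^sup>2)"
  proof -
    have "(1 + x) * (1 - x + x\<^sup>2) = 1 + x ^ 3" by algebra
    then show ?thesis using x by simp
  qed
  also have "\<dots> \<le> exp x * (1 - x + x\<^sup>2)"
    using x exp_ge_add_one_self[of x] by (intro mult_right_mono) auto
  finally have "1 / exp x \<le> 1 - x + x\<^sup>2" by (simp add: divide_le_eq mult.commute)
  then show ?thesis by (simp add: x_def exp_minus field_simps)
qed

text \<open>
  The moment generating function bound behind Chernoff's inequality, for the uniform distribution
  on \<open>G\<close>: the linear term of the exponential averages out, and the quadratic one is at most \<open>\<theta>\<^sup>2\<close>.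
\<close>

lemma sum_exp_le_of_mean_zero:
  fixes f :: "'a \<Rightarrow> real"
  assumes "finite G" "\<And>g. g \<in> G \<Longrightarrow> \<bar>f g\<bar> \<le> 1" "(\<Sum>g\<in>G. f g) = 0" "0 \<le> \<theta>" "\<theta> \<le> 1"
  shows "(\<Sum>g\<in>G. exp (\<theta> * f g)) \<le> real (card G) * exp (\<theta>\<^sup>2)"
proof -
  have "exp (\<theta> * f g) \<le> 1 + \<theta> * f g + \<theta>\<^sup>2" if "g \<in> G" for g
  proof -
    have "\<bar>\<theta> * f g\<bar> \<le> 1 * 1"
      unfolding abs_mult using assms that by (intro mult_mono) auto
    then have "exp (\<theta> * f g) \<le> 1 + \<theta> * f g + (\<theta> * f g)\<^sup>2" by (intro exp_le_quadratic) simp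
    moreover have "\<theta>\<^sup>2 * (f g)\<^sup>2 \<le> \<theta>\<^sup>2 * 1"
      using assms(2)[OF that] by (intro mult_left_mono) (auto simp: abs_square_le_1)
    ultimately show ?thesis by (simp add: power_mult_distrib)
  qed
  then have "(\<Sum>g\<in>G. exp (\<theta> * f g)) \<le> (\<Sum>g\<in>G. 1 + \<theta> * f g + \<theta>\<^sup>2)" by (rule sum_mono)
  also have "\<dots> = real (card G) * (1 + \<theta>\<^sup>2)"
    using assms(3) by (simp add: sum.distrib flip: sum_distrib_left) (simp add: algebra_simps)
  also have "\<dots> \<le> real (card G) * exp (\<theta>\<^sup>2)"
    by (intro mult_left_mono) auto
  finally show ?thesis .
qed

text \<open>
  Each point is chosen greedily: averaged over all candidates \<open>g\<close> for the next point, the potential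
  grows by a factor of at most \<open>exp (\<theta>\<^sup>2)\<close>, so some candidate does no worse than the average.
\<close>

lemma ex_sequence_small_potential:
  fixes f :: "'b \<Rightarrow> 'a \<Rightarrow> real"
  assumes G: "finite G" "G \<noteq> {}"
    and bound: "\<And>b g. b \<in> F \<Longrightarrow> g \<in> G \<Longrightarrow> \<bar>f b g\<bar> \<le> 1"
    and mean: "\<And>b. b \<in> F \<Longrightarrow> (\<Sum>g\<in>G. f b g) = 0"
    and \<theta>: "0 \<le> \<theta>" "\<theta> \<le> 1"
  shows "\<exists>x. (\<forall>n<N. x n \<in> G) \<and>
    (\<Sum>b\<in>F. exp (\<theta> * (\<Sum>n<N. f b (x n)))) \<le> real (card F) * exp (real N * \<theta>\<^sup>2)"
proof (induction N)
  case 0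
  show ?case by simp
next
  case (Suc N)
  then obtain x where x: "\<forall>n<N. x n \<in> G"
    "(\<Sum>b\<in>F. exp (\<theta> * (\<Sum>n<N. f b (x n)))) \<le> real (card F) * exp (real N * \<theta>\<^sup>2)" by blast
  define P where "P b = exp (\<theta> * (\<Sum>n<N. f b (x n)))" for b
  have "(\<Sum>g\<in>G. \<Sum>b\<in>F. P b * exp (\<theta> * f b g)) = (\<Sum>b\<in>F. P b * (\<Sum>g\<in>G. exp (\<theta> * f b g)))"
    by (subst sum.swap) (simp add: sum_distrib_left)
  also have "\<dots> \<le> (\<Sum>b\<in>F. P b * (real (card G) * exp (\<theta>\<^sup>2)))"
    using G bound mean \<theta>
    by (intro sum_mono mult_left_mono sum_exp_le_of_mean_zero) (auto simp: P_def)
  also have "\<dots> = (\<Sum>g\<in>G. (\<Sum>b\<in>F. P b) * exp (\<theta>\<^sup>2))"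
    by (simp add: sum_distrib_left sum_distrib_right mult_ac)
  finally have "\<exists>g\<in>G. (\<Sum>b\<in>F. P b * exp (\<theta> * f b g)) \<le> (\<Sum>b\<in>F. P b) * exp (\<theta>\<^sup>2)"
    using sum_strict_mono[OF G, of "\<lambda>_. (\<Sum>b\<in>F. P b) * exp (\<theta>\<^sup>2)"
      "\<lambda>g. \<Sum>b\<in>F. P b * exp (\<theta> * f b g)"] by (meson not_le)
  then obtain g where g: "g \<in> G"
    "(\<Sum>b\<in>F. P b * exp (\<theta> * f b g)) \<le> (\<Sum>b\<in>F. P b) * exp (\<theta>\<^sup>2)" by blast
  define y where "y = x(N := g)"
  have "(\<Sum>n<Suc N. f b (y n)) = (\<Sum>n<N. f b (x n)) + f b g" for b
    by (simp add: y_def)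
  then have "(\<Sum>b\<in>F. exp (\<theta> * (\<Sum>n<Suc N. f b (y n)))) = (\<Sum>b\<in>F. P b * exp (\<theta> * f b g))"
    by (simp add: P_def distrib_left exp_add del: sum.lessThan_Suc)
  also have "\<dots> \<le> (real (card F) * exp (real N * \<theta>\<^sup>2)) * exp (\<theta>\<^sup>2)"
    using g(2) x(2) by (auto simp: P_def intro: order_trans)
  also have "\<dots> = real (card F) * exp (real (Suc N) * \<theta>\<^sup>2)"
    by (simp add: exp_add[symmetric] algebra_simps)
  finally show ?case
    using x(1) g(1) by (intro exI[of _ y]) (auto simp: y_def less_Suc_eq)
qed

text \<open>
  The exponential of \<open>\<theta>\<close> times an error is a single summand of the potential, so every error is at
  most \<open>ln (2 * card F) / \<theta> + N * \<theta>\<close>. The choice \<open>\<theta> = \<delta> / 2\<close> makes both terms at most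
  \<open>\<delta> * N / 2\<close> for the given size of \<open>N\<close>.
\<close>

lemma ex_balanced_sequence:
  fixes f :: "'b \<Rightarrow> 'a \<Rightarrow> real"
  assumes G: "finite G" "G \<noteq> {}" and F: "finite F" "F \<noteq> {}"
    and bound: "\<And>b g. b \<in> F \<Longrightarrow> g \<in> G \<Longrightarrow> \<bar>f b g\<bar> \<le> 1"
    and mean: "\<And>b. b \<in> F \<Longrightarrow> (\<Sum>g\<in>G. f b g) = 0"
    and \<delta>: "0 < \<delta>" "\<delta> \<le> 1"
    and N: "4 * ln (2 * real (card F)) / \<delta>\<^sup>2 \<le> real N"
  shows "\<exists>x. (\<forall>n<N. x n \<in> G) \<and> (\<forall>b\<in>F. \<bar>\<Sum>n<N. f b (x n)\<bar> \<le> \<delta> * real N)"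
proof -
  \<comment> \<open>The signs turn the upper bounds on the errors into bounds on their absolute values.\<close>
  define S where "S = {1, -1 :: real}"
  have S: "finite S" "card S = 2" by (auto simp: S_def)
  define \<theta> where "\<theta> = \<delta> / 2"
  have \<theta>: "0 < \<theta>" "\<theta> \<le> 1" using \<delta> by (auto simp: \<theta>_def)
  have "\<exists>x. (\<forall>n<N. x n \<in> G) \<and>
    (\<Sum>p\<in>F \<times> S. exp (\<theta> * (\<Sum>n<N. snd p * f (fst p) (x n))))
      \<le> real (card (F \<times> S)) * exp (real N * \<theta>\<^sup>2)"
    using G bound mean \<theta>
    by (intro ex_sequence_small_potential) (auto simp: S_def sum_negf)
  then obtain x where x: "\<forall>n<N. x n \<in> G" and
    pot: "(\<Sum>p\<in>F \<times> S. exp (\<theta> * (\<Sum>n<N. snd p * f (fst p) (x n))))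
      \<le> real (card (F \<times> S)) * exp (real N * \<theta>\<^sup>2)" by blast
  have M: "0 < 2 * real (card F)" using F by (simp add: card_gt_0_iff)
  have side: "\<sigma> * (\<Sum>n<N. f b (x n)) \<le> \<delta> * real N" if "b \<in> F" "\<sigma> \<in> S" for b \<sigma>
  proof -
    have "exp (\<theta> * (\<sigma> * (\<Sum>n<N. f b (x n))))
        \<le> (\<Sum>p\<in>F \<times> S. exp (\<theta> * (\<Sum>n<N. snd p * f (fst p) (x n))))"
      using member_le_sum[of "(b, \<sigma>)" "F \<times> S" "\<lambda>p. exp (\<theta> * (\<Sum>n<N. snd p * f (fst p) (x n)))"]
        that F S by (simp add: sum_distrib_left)
    also have "\<dots> \<le> 2 * real (card F) * exp (real N * \<theta>\<^sup>2)"
      using pot S by (simp add: card_cartesian_product mult_ac)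
    also have "\<dots> = exp (ln (2 * real (card F)) + real N * \<theta>\<^sup>2)"
      using M by (simp add: exp_add)
    finally have "\<theta> * (\<sigma> * (\<Sum>n<N. f b (x n))) \<le> ln (2 * real (card F)) + real N * \<theta>\<^sup>2"
      by simp
    also have "\<dots> \<le> real N * \<delta>\<^sup>2 / 4 + real N * \<theta>\<^sup>2"
      using N \<delta> by (simp add: field_simps)
    also have "\<dots> = \<theta> * (\<delta> * real N)"
      by (simp add: \<theta>_def field_simps power2_eq_square)
    finally show ?thesis using \<theta> by simp
  qed
  have "\<bar>\<Sum>n<N. f b (x n)\<bar> \<le> \<delta> * real N" if "b \<in> F" for b
    using side[OF that, of 1] side[OF that, of "-1"] by (auto simp: S_def)
  then show ?thesis using x by blast
qed

section \<open>Point sets of small star discrepancy\<close>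

lemma card_grid_box:
  fixes k :: "nat \<Rightarrow> nat"
  assumes "k \<in> (\<Pi>\<^sub>E i\<in>{1..s}. {0..m})"
  shows "card {g \<in> (\<Pi>\<^sub>E i\<in>{1..s}. {0..<m}). \<forall>i\<in>{1..s}. g i < k i} = (\<Prod>i\<in>{1..s}. k i)"
proof -
  have "{g \<in> (\<Pi>\<^sub>E i\<in>{1..s}. {0..<m}). \<forall>i\<in>{1..s}. g i < k i} = (\<Pi>\<^sub>E i\<in>{1..s}. {0..<k i})"
  proof (intro set_eqI iffI)
    fix g assume "g \<in> (\<Pi>\<^sub>E i\<in>{1..s}. {0..<k i})"
    moreover have "g i < m" if "g i < k i" "i \<in> {1..s}" for i
      using that PiE_mem[OF assms that(2)] by simp
    ultimately show "g \<in> {g \<in> (\<Pi>\<^sub>E i\<in>{1..s}. {0..<m}). \<forall>i\<in>{1..s}. g i < k i}"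
      by (simp add: PiE_iff)
  qed (simp add: PiE_iff)
  then show ?thesis by (simp add: card_PiE)
qed

text \<open>
  Balancing is applied to the centred indicators of the \<open>(m + 1) ^ s\<close> grid boxes. They have mean
  exactly zero over the grid, because the share of grid points in a half-open grid box equals its
  volume.
\<close>

lemma ex_grid_sequence_balanced:
  fixes s m N :: nat
  assumes m: "1 \<le> m" and \<delta>: "0 < \<delta>" "\<delta> \<le> 1"
    and N: "4 * ln (2 * (real m + 1) ^ s) / \<delta>\<^sup>2 \<le> real N" and N1: "1 \<le> N"
  shows "\<exists>g. (\<forall>n<N. g n \<in> (\<Pi>\<^sub>E i\<in>{1..s}. {0..<m})) \<and>
    (\<forall>k\<in>(\<Pi>\<^sub>E i\<in>{1..s}. {0..m}).
       \<bar>real (card {n. n < N \<and> (\<forall>i\<in>{1..s}. g n i < k i)}) / real N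
          - (\<Prod>i\<in>{1..s}. real (k i) / real m)\<bar> \<le> \<delta>)"
proof -
  define G where "G = (\<Pi>\<^sub>E i\<in>{1..s}. {0..<m})"
  define F where "F = (\<Pi>\<^sub>E i\<in>{1..s}. {0..m})"
  define vol where "vol k = (\<Prod>i\<in>{1..s}. real (k i) / real m)" for k :: "nat \<Rightarrow> nat"
  define below where "below k g \<longleftrightarrow> (\<forall>i\<in>{1..s}. g i < k i)" for k g :: "nat \<Rightarrow> nat"
  have G: "finite G" "G \<noteq> {}" "card G = m ^ s"
    using m by (auto simp: G_def PiE_eq_empty_iff card_PiE intro!: finite_PiE)
  have F: "finite F" "F \<noteq> {}" "card F = (m + 1) ^ s"
    by (auto simp: F_def PiE_eq_empty_iff card_PiE intro!: finite_PiE)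
  have vol: "0 \<le> vol k" "vol k \<le> 1" if "k \<in> F" for k
    using that m by (auto simp: vol_def F_def PiE_iff intro!: prod_nonneg prod_le_1)
  have "\<exists>x. (\<forall>n<N. x n \<in> G) \<and>
      (\<forall>k\<in>F. \<bar>\<Sum>n<N. of_bool (below k (x n)) - vol k\<bar> \<le> \<delta> * real N)"
  proof (rule ex_balanced_sequence[OF G(1,2) F(1,2) _ _ \<delta>])
    show "4 * ln (2 * real (card F)) / \<delta>\<^sup>2 \<le> real N"
      using N by (simp add: F(3) add.commute)
    show "\<bar>of_bool (below k g) - vol k\<bar> \<le> 1" if "k \<in> F" "g \<in> G" for k g
      using vol[OF that(1)] by (cases "below k g") auto
    show "(\<Sum>g\<in>G. of_bool (below k g) - vol k) = 0" if "k \<in> F" for k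
    proof -
      have "(\<Sum>g\<in>G. of_bool (below k g) :: real) = real (card {g \<in> G. below k g})"
        using G(1) by (simp add: Int_def)
      also have "\<dots> = real (\<Prod>i\<in>{1..s}. k i)"
        using card_grid_box[of k s m] that by (simp add: G_def F_def below_def)
      also have "\<dots> = real (card G) * vol k"
        using m by (simp add: G(3) vol_def prod_dividef)
      finally show ?thesis by (simp add: sum_subtractf)
    qed
  qed
  then obtain x where x: "\<forall>n<N. x n \<in> G"
    "\<And>k. k \<in> F \<Longrightarrow> \<bar>\<Sum>n<N. of_bool (below k (x n)) - vol k\<bar> \<le> \<delta> * real N" by blast
  have "\<bar>real (card {n. n < N \<and> below k (x n)}) / real N - vol k\<bar> \<le> \<delta>" if "k \<in> F" for k
  proof -
    have "(\<Sum>n<N. of_bool (below k (x n)) - vol k)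
        = real (card {n. n < N \<and> below k (x n)}) - real N * vol k"
      by (simp add: sum_subtractf Int_def lessThan_def)
    also have "\<dots> = real N * (real (card {n. n < N \<and> below k (x n)}) / real N - vol k)"
      using N1 by (simp add: right_diff_distrib)
    finally show ?thesis
      using x(2)[OF that] N1 by (simp add: abs_mult mult.commute)
  qed
  then show ?thesis
    using x(1) unfolding G_def F_def vol_def below_def by blast
qed

text \<open>
  The coordinates of the points are multiples of \<open>1 / m\<close>, so the half-open box with sides \<open>z i\<close>
  contains exactly the same of them as the box with sides \<open>\<lceil>m * z i\<rceil> / m\<close>. Replacing the former
  by the latter therefore costs only the difference of the volumes.
\<close>

lemma ex_point_set_small_discrepancy:
  fixes s m N :: nat
  assumes m: "1 \<le> m" and \<delta>: "0 < \<delta>" "\<delta> \<le> 1"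
    and N: "4 * ln (2 * (real m + 1) ^ s) / \<delta>\<^sup>2 \<le> real N" and N1: "1 \<le> N"
  shows "\<exists>x\<in>point_sets N s. \<forall>z. (\<forall>i\<in>{1..s}. 0 \<le> z i \<and> z i \<le> 1) \<longrightarrow>
    \<bar>discrepancy_fun s N x z\<bar> \<le> \<delta> + real s / real m"
proof -
  obtain g where g: "\<And>n. n < N \<Longrightarrow> g n \<in> (\<Pi>\<^sub>E i\<in>{1..s}. {0..<m})"
    and bal: "\<And>k. k \<in> (\<Pi>\<^sub>E i\<in>{1..s}. {0..m}) \<Longrightarrow>
       \<bar>real (card {n. n < N \<and> (\<forall>i\<in>{1..s}. g n i < k i)}) / real N
          - (\<Prod>i\<in>{1..s}. real (k i) / real m)\<bar> \<le> \<delta>"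
    using ex_grid_sequence_balanced[OF assms] by blast
  define x where "x n = (\<lambda>i\<in>{1..s}. real (g n i) / real m)" for n
  have "x \<in> point_sets N s"
    using g m by (simp add: point_sets_def half_open_unit_cube_def x_def PiE_iff)
  moreover have "\<bar>discrepancy_fun s N x z\<bar> \<le> \<delta> + real s / real m"
    if z: "\<And>i. i \<in> {1..s} \<Longrightarrow> 0 \<le> z i \<and> z i \<le> 1" for z
  proof -
    define k where "k = (\<lambda>i\<in>{1..s}. nat \<lceil>real m * z i\<rceil>)"
    have kz: "real m * z i \<le> real (k i)" "real (k i) \<le> real m * z i + 1" "k i \<le> m"
      if "i \<in> {1..s}" for i
    proof -
      have "0 \<le> real m * z i" "real m * z i \<le> real m"
        using z[OF that] by (auto intro: mult_left_le)
      then show "real m * z i \<le> real (k i)" "real (k i) \<le> real m * z i + 1" "k i \<le> m"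
        using that by (auto simp: k_def ceiling_le_iff nat_le_iff real_nat_ceiling_ge)
    qed
    have below: "real (g n i) / real m < z i \<longleftrightarrow> g n i < k i" if "i \<in> {1..s}" for n i
    proof -
      have "real (g n i) / real m < z i \<longleftrightarrow> real (g n i) < real m * z i"
        using m by (simp add: field_simps)
      also have "\<dots> \<longleftrightarrow> g n i < k i"
        using that by (simp add: k_def) linarith
      finally show ?thesis .
    qed
    have "{n. n < N \<and> x n \<in> (\<Pi>\<^sub>E i\<in>{1..s}. {0..<z i})} = {n. n < N \<and> (\<forall>i\<in>{1..s}. g n i < k i)}"
      using below by (auto simp: x_def PiE_iff)
    then have count: "count_in N x (\<Pi>\<^sub>E i\<in>{1..s}. {0..<z i})
        = card {n. n < N \<and> (\<forall>i\<in>{1..s}. g n i < k i)}"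
      by (simp add: count_in_def)
    have "\<bar>(\<Prod>i\<in>{1..s}. real (k i) / real m) - (\<Prod>i\<in>{1..s}. z i)\<bar>
        \<le> (\<Sum>i\<in>{1..s}. \<bar>real (k i) / real m - z i\<bar>)"
      using norm_prod_diff[of "{1..s}" "\<lambda>i. real (k i) / real m" z] kz(3) z m by simp
    also have "\<dots> \<le> (\<Sum>i\<in>{1..s}. 1 / real m)"
    proof (rule sum_mono)
      fix i assume "i \<in> {1..s}"
      then have "\<bar>(real (k i) - real m * z i) / real m\<bar> \<le> 1 / real m"
        using kz(1,2)[of i] unfolding abs_divide by (intro divide_mono) (use m in auto)
      then show "\<bar>real (k i) / real m - z i\<bar> \<le> 1 / real m"
        using m by (simp add: diff_divide_distrib)
    qed
    finally have "\<bar>(\<Prod>i\<in>{1..s}. real (k i) / real m) - (\<Prod>i\<in>{1..s}. z i)\<bar> \<le> real s / real m"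
      by simp
    moreover have "k \<in> (\<Pi>\<^sub>E i\<in>{1..s}. {0..m})"
      using kz(3) by (auto simp: k_def)
    ultimately show ?thesis
      using bal[of k] unfolding discrepancy_fun_def count by linarith
  qed
  ultimately show ?thesis by blast
qed

section \<open>From the star discrepancy to the weighted star discrepancy\<close>

lemma pad_ones_unit:
  assumes "z \<in> unit_cube s" "i \<in> {1..s}"
  shows "0 \<le> pad_ones u z i" "pad_ones u z i \<le> 1"
  using assms by (auto simp: pad_ones_def unit_cube_def PiE_iff)

lemma unit_cube_nonempty: "unit_cube s \<noteq> {}"
  by (auto simp: unit_cube_def PiE_eq_empty_iff)

lemma index_sets:
  fixes s :: nat
  assumes "1 \<le> s"
  shows "finite {u. u \<noteq> {} \<and> u \<subseteq> {1..s}}" "{1..s} \<in> {u. u \<noteq> {} \<and> u \<subseteq> {1..s}}"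
  using assms by (auto intro: finite_subset[of _ "Pow {1..s}"])

lemma weighted_Max_le:
  assumes s: "1 \<le> s" and z: "z \<in> unit_cube s"
    and w: "\<And>u. u \<subseteq> {1..s} \<Longrightarrow> 0 \<le> w u \<and> w u \<le> K"
    and D: "\<And>z. (\<forall>i\<in>{1..s}. 0 \<le> z i \<and> z i \<le> 1) \<Longrightarrow> \<bar>discrepancy_fun s N x z\<bar> \<le> D"
  shows "Max ((\<lambda>u. w u * \<bar>discrepancy_fun s N x (pad_ones u z)\<bar>) ` {u. u \<noteq> {} \<and> u \<subseteq> {1..s}})
    \<le> K * D"
proof (rule Max.boundedI)
  show "finite ((\<lambda>u. w u * \<bar>discrepancy_fun s N x (pad_ones u z)\<bar>) ` {u. u \<noteq> {} \<and> u \<subseteq> {1..s}})"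
    using index_sets(1)[OF s] by (rule finite_imageI)
  show "(\<lambda>u. w u * \<bar>discrepancy_fun s N x (pad_ones u z)\<bar>) ` {u. u \<noteq> {} \<and> u \<subseteq> {1..s}} \<noteq> {}"
    using index_sets(2)[OF s] by blast
  fix a assume "a \<in> (\<lambda>u. w u * \<bar>discrepancy_fun s N x (pad_ones u z)\<bar>) ` {u. u \<noteq> {} \<and> u \<subseteq> {1..s}}"
  then obtain u where u: "u \<subseteq> {1..s}" "a = w u * \<bar>discrepancy_fun s N x (pad_ones u z)\<bar>" by blast
  have "\<bar>discrepancy_fun s N x (pad_ones u z)\<bar> \<le> D"
    by (rule D) (use pad_ones_unit[OF z] in blast)
  then show "a \<le> K * D"
    unfolding u(2) using w[OF u(1)] by (intro mult_mono) auto
qed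

lemma abs_discrepancy_fun_le_1:
  assumes "\<forall>i\<in>{1..s}. 0 \<le> z i \<and> z i \<le> 1"
  shows "\<bar>discrepancy_fun s N x z\<bar> \<le> 1"
proof -
  have "count_in N x E \<le> N" for E
    using card_mono[of "{..<N}" "{n. n < N \<and> x n \<in> E}"] by (auto simp: count_in_def)
  then have "0 \<le> real (count_in N x E) / real N" "real (count_in N x E) / real N \<le> 1" for E
    by (auto simp: divide_le_eq)
  moreover have "0 \<le> (\<Prod>i\<in>{1..s}. z i)" "(\<Prod>i\<in>{1..s}. z i) \<le> 1"
    using assms by (auto intro!: prod_nonneg prod_le_1)
  ultimately show ?thesis
    unfolding discrepancy_fun_def by (smt (verit))
qed

text \<open>
  A real supremum is only meaningful for a bounded set, which is why boundedness of the weights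
  enters even here.
\<close>

lemma weighted_star_discrepancy_nonneg:
  assumes s: "1 \<le> s" and w: "\<And>u. u \<subseteq> {1..s} \<Longrightarrow> 0 \<le> w u \<and> w u \<le> K"
  shows "0 \<le> weighted_star_discrepancy w s N x"
proof -
  obtain z where z: "z \<in> unit_cube s" using unit_cube_nonempty by blast
  let ?M = "\<lambda>z. Max ((\<lambda>u. w u * \<bar>discrepancy_fun s N x (pad_ones u z)\<bar>) ` {u. u \<noteq> {} \<and> u \<subseteq> {1..s}})"
  have "0 \<le> w {1..s} * \<bar>discrepancy_fun s N x (pad_ones {1..s} z)\<bar>" using w by simp
  also have "\<dots> \<le> ?M z"
    using index_sets[OF s] by (intro Max_ge) blast+
  also have "\<dots> \<le> weighted_star_discrepancy w s N x"
    unfolding weighted_star_discrepancy_def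
  proof (rule cSUP_upper[OF z])
    show "bdd_above (?M ` unit_cube s)"
      using weighted_Max_le[where w = w and D = 1, OF s _ w abs_discrepancy_fun_le_1]
      by (intro bdd_aboveI2) blast
  qed
  finally show ?thesis .
qed

lemma disc_le:
  assumes s: "1 \<le> s" and w: "\<And>u. u \<subseteq> {1..s} \<Longrightarrow> 0 \<le> w u \<and> w u \<le> K"
    and x: "x \<in> point_sets N s"
    and D: "\<And>z. (\<forall>i\<in>{1..s}. 0 \<le> z i \<and> z i \<le> 1) \<Longrightarrow> \<bar>discrepancy_fun s N x z\<bar> \<le> D"
  shows "disc w N s \<le> K * D"
proof -
  have "disc w N s \<le> weighted_star_discrepancy w s N x"
    unfolding disc_def
    using weighted_star_discrepancy_nonneg[OF s w] x by (intro cINF_lower bdd_belowI2) auto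
  also have "\<dots> \<le> K * D"
    unfolding weighted_star_discrepancy_def
    using unit_cube_nonempty weighted_Max_le[OF s _ w D] by (intro cSUP_least) auto
  finally show ?thesis .
qed

section \<open>Tractability\<close>

text \<open>
  The allowed error \<open>\<epsilon> / K\<close> is split into equal halves \<open>\<delta>\<close>, one for the balancing and one for the
  rounding to the grid. The latter requires \<open>m \<ge> s / \<delta>\<close>, so the balancing needs
  \<open>4 * ln (2 * (m + 1) ^ s) / \<delta>\<^sup>2 \<le> 4 * s * ln (8 * K * s / \<epsilon>) / \<delta>\<^sup>2\<close> points. The constant comes
  from \<open>ln y \<le> y powr \<eta> / \<eta>\<close>, and its summand 1 from rounding \<open>N\<close> up to a positive integer.
\<close>

lemma N_min_le:
  assumes s: "1 \<le> s" and w: "\<And>u. u \<subseteq> {1..s} \<Longrightarrow> 0 \<le> w u \<and> w u \<le> K" and K: "1 \<le> K"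
    and \<epsilon>: "0 < \<epsilon>" "\<epsilon> < 1" and \<eta>: "0 < \<eta>"
  shows "ereal_of_enat (N_min w \<epsilon> s)
    \<le> ereal ((1 + 16 * (8 * K) powr \<eta> * K\<^sup>2 / \<eta>) * real s powr (1 + \<eta>) * \<epsilon> powr (- (2 + \<eta>)))"
proof -
  define \<delta> where "\<delta> = \<epsilon> / (2 * K)"
  define m where "m = nat \<lceil>real s / \<delta>\<rceil>"
  define L where "L = 4 * ln (2 * (real m + 1) ^ s) / \<delta>\<^sup>2"
  define N where "N = max 1 (nat \<lceil>L\<rceil>)"
  have \<delta>: "0 < \<delta>" "\<delta> \<le> 1/2" using \<epsilon> K by (auto simp: \<delta>_def field_simps)
  have sd: "1 < real s / \<delta>" using s \<delta> by (simp add: field_simps)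
  then have m: "1 \<le> m" "real s / \<delta> \<le> real m" "real m \<le> real s / \<delta> + 1"
    unfolding m_def by linarith+
  have "\<exists>x\<in>point_sets N s. \<forall>z. (\<forall>i\<in>{1..s}. 0 \<le> z i \<and> z i \<le> 1) \<longrightarrow>
    \<bar>discrepancy_fun s N x z\<bar> \<le> \<delta> + real s / real m"
    using m(1) \<delta> by (intro ex_point_set_small_discrepancy)
      (auto simp: N_def L_def intro: real_nat_ceiling_ge[THEN order_trans])
  then obtain x where x: "x \<in> point_sets N s"
    "\<And>z. (\<forall>i\<in>{1..s}. 0 \<le> z i \<and> z i \<le> 1) \<Longrightarrow> \<bar>discrepancy_fun s N x z\<bar> \<le> \<delta> + real s / real m"
    by blast
  have "real s / real m \<le> \<delta>" using m \<delta> by (simp add: field_simps)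
  then have "K * (\<delta> + real s / real m) \<le> K * (\<delta> + \<delta>)" using K by (intro mult_left_mono) auto
  also have "\<dots> = \<epsilon>" using K by (simp add: \<delta>_def)
  finally have "disc w N s \<le> \<epsilon>"
    using disc_le[where w = w, OF s w x] by linarith
  then have "N_min w \<epsilon> s \<le> enat N"
    unfolding N_min_def by (intro INF_lower) (auto simp: N_def)
  then have "ereal_of_enat (N_min w \<epsilon> s) \<le> ereal_of_enat (enat N)"
    by (simp only: ereal_of_enat_le_iff)
  also have "\<dots> = ereal (real N)" by simp
  also have "real N \<le> (1 + 16 * (8 * K) powr \<eta> * K\<^sup>2 / \<eta>) * real s powr (1 + \<eta>) * \<epsilon> powr (- (2 + \<eta>))"
  proof -
    have s1: "1 \<le> real s" using s by simp
    have "ln (2 * (real m + 1) ^ s) \<le> ln ((2 * (real m + 1)) ^ s)"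
      unfolding power_mult_distrib[of 2] using s self_le_power[of "2::real" s] by simp
    also have "\<dots> = real s * ln (2 * (real m + 1))"
      by (rule ln_realpow)
    also have "\<dots> \<le> real s * ((2 * (real m + 1)) powr \<eta> / \<eta>)"
      using \<eta> by (intro mult_left_mono ln_powr_bound) auto
    also have "\<dots> \<le> real s * ((8 * K * real s / \<epsilon>) powr \<eta> / \<eta>)"
    proof -
      have "2 * (real m + 1) \<le> 4 * (real s / \<delta>)"
        using m(3) sd \<delta> s1 by (simp add: field_simps)
      also have "\<dots> = 8 * K * real s / \<epsilon>" by (simp add: \<delta>_def)
      finally show ?thesis
        using \<eta> by (intro mult_left_mono divide_right_mono powr_mono2) auto
    qed
    also have "(8 * K * real s / \<epsilon>) powr \<eta> = (8 * K) powr \<eta> * real s powr \<eta> * \<epsilon> powr (- \<eta>)"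
      using K \<epsilon> by (simp add: powr_mult powr_divide powr_minus_divide)
    finally have ln_le: "ln (2 * (real m + 1) ^ s)
      \<le> real s * ((8 * K) powr \<eta> * real s powr \<eta> * \<epsilon> powr (- \<eta>) / \<eta>)" .
    have "L = 16 * K\<^sup>2 / \<epsilon>\<^sup>2 * ln (2 * (real m + 1) ^ s)"
      by (simp add: L_def \<delta>_def power_divide power_mult_distrib)
    also have "\<dots> \<le> 16 * K\<^sup>2 / \<epsilon>\<^sup>2 * (real s * ((8 * K) powr \<eta> * real s powr \<eta> * \<epsilon> powr (- \<eta>) / \<eta>))"
      using ln_le by (intro mult_left_mono) auto
    also have "\<dots> = 16 * (8 * K) powr \<eta> * K\<^sup>2 / \<eta> * (real s powr (1 + \<eta>) * \<epsilon> powr (- (2 + \<eta>)))"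
    proof -
      have "\<epsilon> powr (- (2 + \<eta>)) = \<epsilon> powr (- \<eta>) / \<epsilon>\<^sup>2"
        using \<epsilon> by (simp add: powr_diff flip: powr_numeral) (simp add: powr_minus_divide powr_add powr_diff)
      moreover have "real s powr (1 + \<eta>) = real s * real s powr \<eta>"
        using s1 by (simp add: powr_add)
      ultimately show ?thesis by (simp add: field_simps)
    qed
    finally have L: "L \<le> 16 * (8 * K) powr \<eta> * K\<^sup>2 / \<eta> * (real s powr (1 + \<eta>) * \<epsilon> powr (- (2 + \<eta>)))" .
    have "1 \<le> \<epsilon> powr (- (2 + \<eta>))"
      unfolding powr_minus using \<epsilon> \<eta> by (intro one_le_inverse powr_le1) auto
    moreover have "1 \<le> real s powr (1 + \<eta>)"
      using s1 \<eta> by (intro ge_one_powr_ge_zero) auto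
    ultimately have "1 * 1 \<le> real s powr (1 + \<eta>) * \<epsilon> powr (- (2 + \<eta>))"
      by (intro mult_mono) auto
    moreover have "0 \<le> L"
    proof -
      have "1 * 1 \<le> 2 * (real m + 1) ^ s" by (intro mult_mono one_le_power) auto
      then show ?thesis by (simp add: L_def)
    qed
    then have "real N \<le> 1 + L" unfolding N_def by linarith
    ultimately show ?thesis using L by (simp add: algebra_simps)
  qed
  finally show ?thesis by simp
qed

lemma tractability_bound_of_bounded_weights:
  assumes w: "\<And>u. finite u \<Longrightarrow> u \<subseteq> {1..} \<Longrightarrow> 0 \<le> w u \<and> w u \<le> K" and \<eta>: "0 < \<eta>"
  shows "\<exists>C\<ge>0. tractability_bound w C (1 + \<eta>) (2 + \<eta>)"
proof (intro exI conjI)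
  let ?K = "max 1 K"
  let ?C = "1 + 16 * (8 * ?K) powr \<eta> * ?K\<^sup>2 / \<eta>"
  show "0 \<le> ?C" using \<eta> by (intro add_nonneg_nonneg divide_nonneg_pos) auto
  have w': "0 \<le> w u \<and> w u \<le> ?K" if "u \<subseteq> {1..s}" for s u
    using w[of u] that finite_subset[OF that] by fastforce
  show "tractability_bound w ?C (1 + \<eta>) (2 + \<eta>)"
    unfolding tractability_bound_def using N_min_le[OF _ w' _ _ _ \<eta>] by auto
qed

lemma tractability_bound_mono:
  assumes "tractability_bound w C a b" "0 \<le> C" "a \<le> a'"
  shows "tractability_bound w C a' b"
  unfolding tractability_bound_def
proof (intro allI impI)
  fix s :: nat and \<epsilon> :: real
  assume s: "1 \<le> s" and \<epsilon>: "0 < \<epsilon> \<and> \<epsilon> < 1"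
  have "ereal_of_enat (N_min w \<epsilon> s) \<le> ereal (C * real s powr a * \<epsilon> powr (- b))"
    using assms(1) s \<epsilon> by (auto simp: tractability_bound_def)
  also have "\<dots> \<le> ereal (C * real s powr a' * \<epsilon> powr (- b))"
    using s assms(2,3) by (auto intro!: mult_right_mono mult_left_mono powr_mono)
  finally show "ereal_of_enat (N_min w \<epsilon> s) \<le> ereal (C * real s powr a' * \<epsilon> powr (- b))" .
qed

lemma product_weights_bounded:
  fixes \<gamma> :: "nat \<Rightarrow> real"
  assumes pos: "\<forall>j\<ge>1. 0 < \<gamma> j" and t: "0 < t" and summ: "summable (\<lambda>j. \<gamma> (Suc j) powr t)"
  shows "\<exists>K. \<forall>u. finite u \<and> u \<subseteq> {1..} \<longrightarrow> 0 \<le> product_weights \<gamma> u \<and> product_weights \<gamma> u \<le> K"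
proof -
  have "eventually (\<lambda>j. \<gamma> (Suc j) powr t < 1) sequentially"
    using summable_LIMSEQ_zero[OF summ] by (rule order_tendstoD) simp
  then obtain J where J: "\<And>j. j \<ge> J \<Longrightarrow> \<gamma> (Suc j) powr t < 1"
    by (auto simp: eventually_sequentially)
  have small: "\<gamma> j \<le> 1" if "j > J" for j
  proof (rule ccontr)
    assume "\<not> \<gamma> j \<le> 1"
    then have "1 \<le> \<gamma> j powr t" using t by (intro ge_one_powr_ge_zero) auto
    then show False using J[of "j - 1"] that by (cases j) auto
  qed
  have "product_weights \<gamma> u \<le> (\<Prod>j\<in>{1..J}. max 1 (\<gamma> j))" if u: "finite u" "u \<subseteq> {1..}" for u
  proof -
    have "product_weights \<gamma> u \<le> (\<Prod>j\<in>u. if j \<in> {1..J} then max 1 (\<gamma> j) else 1)"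
      unfolding product_weights_def
    proof (rule prod_mono)
      fix j assume "j \<in> u"
      then have "1 \<le> j" using u by auto
      then show "0 \<le> \<gamma> j \<and> \<gamma> j \<le> (if j \<in> {1..J} then max 1 (\<gamma> j) else 1)"
        using pos small[of j] by (auto intro: less_imp_le)
    qed
    also have "\<dots> = (\<Prod>j\<in>u \<inter> {1..J}. max 1 (\<gamma> j))"
      using u by (simp add: prod.inter_restrict)
    also have "\<dots> \<le> (\<Prod>j\<in>{1..J}. max 1 (\<gamma> j))"
      by (intro prod_mono2) auto
    finally show ?thesis .
  qed
  moreover have "0 \<le> product_weights \<gamma> u" if "u \<subseteq> {1..}" for u
    unfolding product_weights_def using pos that by (intro prod_nonneg) (auto intro: less_imp_le)
  ultimately show ?thesis by blast
qed

text \<open>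
  The bound with powers \<open>1 + \<eta>\<close> and \<open>2 + \<eta>\<close> yields all claims: \<open>\<eta> = 1\<close> gives the power 2 of \<open>s\<close>,
  and \<open>\<eta> \<rightarrow> 0\<close> the infimum of the powers of \<open>1 / \<epsilon>\<close>.
\<close>

theorem mainTheorem4:
  fixes \<gamma> :: "nat \<Rightarrow> real" and t :: real
  assumes pos: "\<forall>j\<ge>1. 0 < \<gamma> j"
    and noninc: "\<forall>i\<ge>1. \<forall>j\<ge>i. \<gamma> j \<le> \<gamma> i"
    and t_pos: "0 < t"
    and summ: "summable (\<lambda>j. \<gamma> (Suc j) powr t)"
  shows "polynomially_tractable (product_weights \<gamma>)
    \<and> s_exponent (product_weights \<gamma>) \<le> 2
    \<and> eps_exponent (product_weights \<gamma>) \<le> 2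
    \<and> exponents_jointly_at_most (product_weights \<gamma>) 2 2"
proof -
  let ?w = "product_weights \<gamma>"
  obtain K where "\<And>u. finite u \<Longrightarrow> u \<subseteq> {1..} \<Longrightarrow> 0 \<le> ?w u \<and> ?w u \<le> K"
    using product_weights_bounded[OF pos t_pos summ] by blast
  then have bound: "\<exists>C\<ge>0. tractability_bound ?w C (1 + \<eta>) (2 + \<eta>)" if "0 < \<eta>" for \<eta>
    using that by (rule tractability_bound_of_bounded_weights)
  have "\<exists>C\<ge>0. tractability_bound ?w C (2 + \<eta>) (2 + \<eta>)" if "0 < \<eta>" for \<eta>
    using bound[OF that] tractability_bound_mono[where a = "1 + \<eta>" and a' = "2 + \<eta>"] by force
  then have joint: "exponents_jointly_at_most ?w 2 2"
    by (simp add: exponents_jointly_at_most_def)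
  obtain C where C: "0 \<le> C" "tractability_bound ?w C 2 3"
    using bound[of 1] by auto
  have "polynomially_tractable ?w"
    unfolding polynomially_tractable_def
    using C by (intro exI[of _ C] exI[of _ "2::real"] exI[of _ "3::real"]) simp
  moreover have "s_exponent ?w \<le> 2"
    unfolding s_exponent_def
  proof (rule cInf_lower)
    show "2 \<in> {\<alpha>. 0 < \<alpha> \<and> (\<exists>\<beta>>0. \<exists>C\<ge>0. tractability_bound ?w C \<alpha> \<beta>)}"
      using C zero_less_numeral[of Num.num.One] by (intro CollectI conjI exI[of _ "3::real"] exI[of _ C]) auto
    show "bdd_below {\<alpha>. 0 < \<alpha> \<and> (\<exists>\<beta>>0. \<exists>C\<ge>0. tractability_bound ?w C \<alpha> \<beta>)}"
      by (rule bdd_belowI[of _ 0]) auto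
  qed
  moreover have "eps_exponent ?w \<le> 2"
  proof (rule field_le_epsilon)
    fix \<eta> :: real assume \<eta>: "0 < \<eta>"
    have "0 < 1 + \<eta>" "0 < 2 + \<eta>" using \<eta> by simp_all
    then have "2 + \<eta> \<in> {\<beta>. 0 < \<beta> \<and> (\<exists>\<alpha>>0. \<exists>C\<ge>0. tractability_bound ?w C \<alpha> \<beta>)}"
      using bound[OF \<eta>] \<eta> by blast
    then show "eps_exponent ?w \<le> 2 + \<eta>"
      unfolding eps_exponent_def by (intro cInf_lower bdd_belowI[of _ 0]) auto
  qed
  ultimately show ?thesis using joint by blast
qed

end
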